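(* Let $\mathcal N$ be a quantum channel from $\mathcal L(A')$ to $\mathcal L(B)$, let $A\cong A'$, and let $J_{\mathcal N}\in\mathcal L(A\otimes B)$ be its Choi matrix. Let $m\ge 1$ be an integer. Then the optimal average success probability of $\mathcal N$ to transmit $m$ messages assisted by codes that are both no-signalling and PPT-preserving equals the value of the semidefinite program $$f_{\mathrm{NS}\cap\mathrm{PPT}}(\mathcal N,m)=\max\Big\{\operatorname{Tr}J_{\mathcal N}F_{AB}\;:\;0\le F_{AB}\le\rho_A\otimes\mathbb 1_B,\ \operatorname{Tr}\rho_A=1,\ \operatorname{Tr}_AF_{AB}=\tfrac1m\mathbb 1_B,\ 0\le F_{AB}^{T_B}\le\rho_A\otimes\mathbb 1_B\Big\},$$ and the optimal average success probability assisted by no-signalling codes equals $$f_{\mathrm{NS}}(\mathcal N,m)=\max\Big\{\operatorname{Tr}J_{\mathcal N}F_{AB}\;:\;0\le F_{AB}\le\rho_A\otimes\mathbb 1_B,\ \operatorname{Tr}\rho_A=1,\ \operatorname{Tr}_AF_{AB}=\tfrac1m\mathbb 1_B\Big\}.$$ In both programs the maximum is over Hermitian operators $F_{AB}\in\mathcal L(A\otimes B)$ and $\rho_A\in\mathcal L(A)$.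
   Context: All Hilbert spaces are finite-dimensional. A quantum channel is a completely positive trace-preserving linear map. The Choi matrix of $\mathcal N$ is $J_{\mathcal N}=\sum_{i,j}|i\rangle\langle j|_A\otimes\mathcal N(|i\rangle\langle j|_{A'})$. $T_B$ is the partial transpose on $B$: $(|ij\rangle\langle kl|)^{T_B}=|il\rangle\langle kj|$. Codes. A code for $m$ messages over $\mathcal N$ is a bipartite linear map $\Pi$ from $\mathcal L(A_i\otimes B_i)$ to $\mathcal L(A_o\otimes B_o)$, where $A_i=B_o=\mathbb C^m$, $A_o$ is the input system of $\mathcal N$ and $B_i$ is the output system of $\mathcal N$ (so $J_{\mathcal N}\in\mathcal L(A_o\otimes B_i)$). Let $Z=Z_{A_iB_iA_oB_o}$ be its Choi matrix; a subset of the subscripts on $Z$ denotes the marginal obtained by tracing out the other systems. $\Pi$ is a no-signalling (NS) code if $$Z\ge0,\quad Z_{A_iB_i}=\mathbb 1_{A_iB_i},\quad Z_{A_iB_iB_o}=\tfrac{\mathbb 1_{A_i}}{d_{A_i}}\otimes Z_{B_iB_o},\quad Z_{A_iB_iA_o}=\tfrac{\mathbb 1_{B_i}}{d_{B_i}}\otimes Z_{A_iA_o}.$$ It is an NS$\cap$PPT code if in addition $Z^{T_{B_iB_o}}\ge0$. The composition $\mathcal M=\Pi\circ\mathcal N$ is the channel from $A_i$ to $B_o$ with Choi matrix $J_{\mathcal M}=\operatorname{Tr}_{A_oB_i}\big[(J_{\mathcal N}^T\otimes\mathbb 1_{A_iB_o})Z\big]$. The average success probability of $\Pi$ is $f(\mathcal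 N,\Pi,m)=\frac1m\sum_{k=1}^m\operatorname{Tr}\big(\mathcal M(|k\rangle\langle k|)\,|k\rangle\langle k|\big)$ with $\{|k\rangle\}$ the computational basis of $\mathbb C^m$. For a class $\Omega$ of codes, $f_\Omega(\mathcal N,m)=\sup_{\Pi\in\Omega}f(\mathcal N,\Pi,m)$. *)

theory Defs
  imports "HOL-Analysis.Analysis"
begin

text \<open>
  A finite-dimensional system with a chosen orthonormal basis is a finite type (the index set of
  the basis), an operator on it is a square complex matrix, and the tensor product of two systems
  is the product type.
\<close>

type_synonym 'n op = "complex ^ 'n ^ 'n"

definition mscale :: "complex \<Rightarrow> 'n::finite op \<Rightarrow> 'n op"
  where "mscale c A = map_matrix ((*) c) A"

abbreviation op_linear :: "('a::finite op \<Rightarrow> 'b::finite op) \<Rightarrow> bool"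
  where "op_linear \<equiv> Vector_Spaces.linear mscale mscale"

definition adj :: "'n::finite op \<Rightarrow> 'n op"
  where "adj A = map_matrix cnj (transpose A)"

definition hermitian :: "'n::finite op \<Rightarrow> bool"
  where "hermitian A \<longleftrightarrow> adj A = A"

text \<open>
  On complex vectors the library's \<open>v \<bullet> w\<close> is the real part of the Hermitian inner
  product of \<open>v\<close> and \<open>w\<close>.
\<close>

definition psd :: "'n::finite op \<Rightarrow> bool"
  where "psd A \<longleftrightarrow> hermitian A \<and> (\<forall>v. 0 \<le> v \<bullet> (A *v v))"

definition loewner_le :: "'n::finite op \<Rightarrow> 'n op \<Rightarrow> bool" (infix "\<preceq>" 50)
  where "A \<preceq> B \<longleftrightarrow> psd (B - A)"

definition matrix_unit :: "'n::finite \<Rightarrow> 'n \<Rightarrow> 'n op"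
  where "matrix_unit i j = (\<chi> k l. if k = i \<and> l = j then 1 else 0)"

definition kron :: "'a::finite op \<Rightarrow> 'b::finite op \<Rightarrow> ('a \<times> 'b) op" (infixr "\<otimes>" 75)
  where "A \<otimes> B = (\<chi> p q. A $ fst p $ fst q * B $ snd p $ snd q)"

text \<open>
  \<open>reorder h A\<close> is \<open>A\<close> with its tensor factors rearranged, where \<open>h\<close> maps the new
  index to the old one.  \<open>marginal h A\<close> traces out the systems collected in \<open>'y\<close> and keeps
  those in \<open>'x\<close>, where \<open>h (x, y)\<close> is the index of \<open>A\<close> assembled from the
  kept and the traced-out part.
\<close>

definition reorder :: "('x::finite \<Rightarrow> 'n::finite) \<Rightarrow> 'n op \<Rightarrow> 'x op"
  where "reorder h A = (\<chi> p q. A $ h p $ h q)"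

definition marginal :: "('x::finite \<times> 'y::finite \<Rightarrow> 'n::finite) \<Rightarrow> 'n op \<Rightarrow> 'x op"
  where "marginal h A = (\<chi> x x'. \<Sum>y\<in>UNIV. A $ h (x, y) $ h (x', y))"

abbreviation ptrace_fst :: "('a::finite \<times> 'b::finite) op \<Rightarrow> 'b op"
  where "ptrace_fst \<equiv> marginal (\<lambda>(b, a). (a, b))"

definition ptranspose :: "('a::finite \<times> 'b::finite) op \<Rightarrow> ('a \<times> 'b) op"
  where "ptranspose A = (\<chi> p q. A $ (fst p, snd q) $ (fst q, snd p))"

text \<open>
  \<open>block_psd k X\<close>: the \<open>k \<times> k\<close> block matrix with blocks \<open>X i j\<close>, i.e. the operator
  \<open>\<Sum>i j. |i><j| \<otimes> X i j\<close> with a \<open>k\<close>-dimensional first factor, is positive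
  semidefinite.  The ancilla dimension is a natural number so that complete positivity can
  quantify over it.
\<close>

definition block_psd :: "nat \<Rightarrow> (nat \<Rightarrow> nat \<Rightarrow> 'n::finite op) \<Rightarrow> bool"
  where "block_psd k X \<longleftrightarrow>
    (\<forall>i<k. \<forall>j<k. adj (X i j) = X j i) \<and>
    (\<forall>v. 0 \<le> (\<Sum>i<k. \<Sum>j<k. v i \<bullet> (X i j *v v j)))"

definition completely_positive :: "('a::finite op \<Rightarrow> 'b::finite op) \<Rightarrow> bool"
  where "completely_positive N \<longleftrightarrow>
    (\<forall>k X. block_psd k X \<longrightarrow> block_psd k (\<lambda>i j. N (X i j)))"

definition trace_preserving :: "('a::finite op \<Rightarrow> 'b::finite op) \<Rightarrow> bool"
  where "trace_preserving N \<longleftrightarrow> (\<forall>X. trace (N X) = trace X)"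

definition quantum_channel :: "('a::finite op \<Rightarrow> 'b::finite op) \<Rightarrow> bool"
  where "quantum_channel N \<longleftrightarrow> op_linear N \<and> completely_positive N \<and> trace_preserving N"

definition choi :: "('a::finite op \<Rightarrow> 'b::finite op) \<Rightarrow> ('a \<times> 'b) op"
  where "choi N = (\<Sum>i\<in>UNIV. \<Sum>j\<in>UNIV. matrix_unit i j \<otimes> N (matrix_unit i j))"

text \<open>
  The linear map with a given Choi matrix, \<open>X \<mapsto> Tr\<^sub>A ((X\<^sup>T \<otimes> 1) J)\<close>;
  see \<open>choi_of_choi\<close> and \<open>of_choi_choi\<close> below.
\<close>

definition of_choi :: "('a::finite \<times> 'b::finite) op \<Rightarrow> 'a op \<Rightarrow> 'b op"
  where "of_choi J X = ptrace_fst ((transpose X \<otimes> mat 1) ** J)"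

lemma vector_space_mscale: "vector_space (mscale :: complex \<Rightarrow> 'n::finite op \<Rightarrow> 'n op)"
  by unfold_locales (simp_all add: mscale_def vec_eq_iff algebra_simps)

lemma op_linear_iff:
  fixes N :: "'a::finite op \<Rightarrow> 'b::finite op"
  shows "op_linear N \<longleftrightarrow>
    (\<forall>X Y. N (X + Y) = N X + N Y) \<and> (\<forall>c X. N (mscale c X) = mscale c (N X))"
  by (simp add: Vector_Spaces.linear_iff vector_space_mscale)

lemma choi_nth: "choi N $ (i, k) $ (j, l) = N (matrix_unit i j) $ k $ l"
proof -
  have "choi N $ (i, k) $ (j, l) =
      (\<Sum>i'\<in>UNIV. \<Sum>j'\<in>UNIV. if i' = i then if j' = j then N (matrix_unit i' j') $ k $ l else 0 else 0)"
    unfolding choi_def kron_def matrix_unit_def sum_component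
    by (intro sum.cong refl) auto
  also have "\<dots> = (\<Sum>i'\<in>UNIV. if i' = i then N (matrix_unit i' j) $ k $ l else 0)"
    by (intro sum.cong refl) auto
  finally show ?thesis by simp
qed

lemma of_choi_nth:
  "of_choi J X $ k $ l = (\<Sum>i\<in>UNIV. \<Sum>j\<in>UNIV. X $ i $ j * J $ (i, k) $ (j, l))"
proof -
  have "of_choi J X $ k $ l =
      (\<Sum>a\<in>UNIV. \<Sum>i\<in>UNIV. \<Sum>b\<in>UNIV. X $ i $ a * (if k = b then 1 else 0) * J $ (i, b) $ (a, l))"
    by (simp add: of_choi_def marginal_def kron_def matrix_matrix_mult_def transpose_def mat_def
        sum.cartesian_product' flip: UNIV_Times_UNIV)
  also have "\<dots> = (\<Sum>a\<in>UNIV. \<Sum>i\<in>UNIV. X $ i $ a * J $ (i, k) $ (a, l))"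
    by (intro sum.cong refl) (simp add: if_distrib if_distribR cong: if_cong)
  finally show ?thesis by (subst sum.swap)
qed

lemma op_linear_of_choi: "op_linear (of_choi J)"
  by (auto simp: op_linear_iff vec_eq_iff of_choi_nth mscale_def algebra_simps sum.distrib
      sum_distrib_left)

lemma choi_of_choi: "choi (of_choi J) = J"
proof -
  have "choi (of_choi J) $ (i, k) $ (j, l) = J $ (i, k) $ (j, l)" for i k j l
  proof -
    have "choi (of_choi J) $ (i, k) $ (j, l) =
        (\<Sum>i'\<in>UNIV. \<Sum>j'\<in>UNIV. if i' = i then if j' = j then J $ (i', k) $ (j', l) else 0 else 0)"
      unfolding choi_nth of_choi_nth matrix_unit_def by (intro sum.cong refl) auto
    also have "\<dots> = (\<Sum>i'\<in>UNIV. if i' = i then J $ (i', k) $ (j, l) else 0)"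
      by (intro sum.cong refl) auto
    finally show ?thesis by simp
  qed
  then show ?thesis by (simp add: vec_eq_iff)
qed

lemma of_choi_choi:
  fixes N :: "'a::finite op \<Rightarrow> 'b::finite op"
  assumes "op_linear N"
  shows "of_choi (choi N) = N"
proof
  fix X :: "'a op"
  have add: "N (X + Y) = N X + N Y" and scale: "N (mscale c X) = mscale c (N X)" for X Y c
    using assms by (auto simp: op_linear_iff)
  have zero: "N 0 = 0" using add[of 0 0] by simp
  have sum: "N (\<Sum>i\<in>S. f i) = (\<Sum>i\<in>S. N (f i))" if "finite S" for S :: "'a set" and f
    using that by induction (simp_all add: zero add)
  have "X = (\<Sum>i\<in>UNIV. \<Sum>j\<in>UNIV. mscale (X $ i $ j) (matrix_unit i j))"
  proof -
    have "(\<Sum>i\<in>UNIV. \<Sum>j\<in>UNIV. mscale (X $ i $ j) (matrix_unit i j)) $ k $ l = X $ k $ l" for k l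
    proof -
      have "(\<Sum>i\<in>UNIV. \<Sum>j\<in>UNIV. mscale (X $ i $ j) (matrix_unit i j)) $ k $ l =
          (\<Sum>i\<in>UNIV. \<Sum>j\<in>UNIV. if k = i then if l = j then X $ i $ j else 0 else 0)"
        unfolding sum_component mscale_def matrix_unit_def by (intro sum.cong refl) auto
      also have "\<dots> = (\<Sum>i\<in>UNIV. if k = i then X $ i $ l else 0)"
        by (intro sum.cong refl) auto
      finally show ?thesis by simp
    qed
    then show ?thesis by (simp add: vec_eq_iff)
  qed
  then have "N X = N (\<Sum>i\<in>UNIV. \<Sum>j\<in>UNIV. mscale (X $ i $ j) (matrix_unit i j))" by simp
  also have "\<dots> = (\<Sum>i\<in>UNIV. N (\<Sum>j\<in>UNIV. mscale (X $ i $ j) (matrix_unit i j)))"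
    using finite by (rule sum)
  also have "\<dots> = (\<Sum>i\<in>UNIV. \<Sum>j\<in>UNIV. mscale (X $ i $ j) (N (matrix_unit i j)))"
    by (simp add: scale sum)
  finally show "of_choi (choi N) X = N X"
    by (simp add: vec_eq_iff of_choi_nth choi_nth mscale_def)
qed

text \<open>
  Codes for \<open>CARD('m)\<close> messages over maps from operators on \<open>'a\<close> to operators on
  \<open>'b\<close>.  The four systems are \<open>A\<^sub>i = B\<^sub>o = 'm\<close>, \<open>A\<^sub>o = 'a\<close> and
  \<open>B\<^sub>i = 'b\<close>, so the Choi matrix of a code has indices
  \<open>((a\<^sub>i, b\<^sub>i), (a\<^sub>o, b\<^sub>o))\<close>.
\<close>

type_synonym ('m, 'a, 'b) code = "('m \<times> 'b) op \<Rightarrow> ('a \<times> 'm) op"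

type_synonym ('m, 'a, 'b) code_choi = "(('m \<times> 'b) \<times> ('a \<times> 'm)) op"

definition marg_AiBi :: "('m::finite, 'a::finite, 'b::finite) code_choi \<Rightarrow> ('m \<times> 'b) op"
  where "marg_AiBi = marginal (\<lambda>((ai, bi), (ao, bo)). ((ai, bi), (ao, bo)))"

definition marg_AiBiBo :: "('m::finite, 'a::finite, 'b::finite) code_choi \<Rightarrow> ('m \<times> 'b \<times> 'm) op"
  where "marg_AiBiBo = marginal (\<lambda>((ai, bi, bo), ao). ((ai, bi), (ao, bo)))"

definition marg_BiBo :: "('m::finite, 'a::finite, 'b::finite) code_choi \<Rightarrow> ('b \<times> 'm) op"
  where "marg_BiBo = marginal (\<lambda>((bi, bo), (ai, ao)). ((ai, bi), (ao, bo)))"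

text \<open>Here the kept systems are listed as \<open>B\<^sub>i, A\<^sub>i, A\<^sub>o\<close>.\<close>

definition marg_BiAiAo :: "('m::finite, 'a::finite, 'b::finite) code_choi \<Rightarrow> ('b \<times> 'm \<times> 'a) op"
  where "marg_BiAiAo = marginal (\<lambda>((bi, ai, ao), bo). ((ai, bi), (ao, bo)))"

definition marg_AiAo :: "('m::finite, 'a::finite, 'b::finite) code_choi \<Rightarrow> ('m \<times> 'a) op"
  where "marg_AiAo = marginal (\<lambda>((ai, ao), (bi, bo)). ((ai, bi), (ao, bo)))"

definition ns_code :: "('m::finite, 'a::finite, 'b::finite) code \<Rightarrow> bool"
  where "ns_code C \<longleftrightarrow> op_linear C \<and> (let Z = choi C in
    psd Z \<and>
    marg_AiBi Z = mat 1 \<and>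
    marg_AiBiBo Z = mscale (1 / of_nat CARD('m)) (mat 1) \<otimes> marg_BiBo Z \<and>
    marg_BiAiAo Z = mscale (1 / of_nat CARD('b)) (mat 1) \<otimes> marg_AiAo Z)"

text \<open>
  The factors are regrouped as \<open>(A\<^sub>i A\<^sub>o)(B\<^sub>i B\<^sub>o)\<close>, after which the transpose on
  \<open>B\<^sub>i B\<^sub>o\<close> is the partial transpose on the second factor.
\<close>

definition ppt_code :: "('m::finite, 'a::finite, 'b::finite) code \<Rightarrow> bool"
  where "ppt_code C \<longleftrightarrow>
    psd (ptranspose (reorder (\<lambda>((ai, ao), (bi, bo)). ((ai, bi), (ao, bo))) (choi C)))"

definition compose_choi ::
    "('m::finite, 'a::finite, 'b::finite) code \<Rightarrow> ('a op \<Rightarrow> 'b op) \<Rightarrow> ('m \<times> 'm) op"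
  where "compose_choi C N =
    marginal (\<lambda>((ai, bo), (ao, bi)). ((ai, bi), (ao, bo)))
      (reorder (\<lambda>((ai, bi), (ao, bo)). ((ao, bi), (ai, bo))) (transpose (choi N) \<otimes> mat 1) **
       choi C)"

definition compose_code ::
    "('m::finite, 'a::finite, 'b::finite) code \<Rightarrow> ('a op \<Rightarrow> 'b op) \<Rightarrow> 'm op \<Rightarrow> 'm op"
  where "compose_code C N = of_choi (compose_choi C N)"

text \<open>
  The trace below is a real number whenever \<open>N\<close> is a channel and the Choi matrix of \<open>C\<close>
  is positive semidefinite, so taking the real part only changes the type.
\<close>

definition success_prob ::
    "('a op \<Rightarrow> 'b op) \<Rightarrow> ('m::finite, 'a::finite, 'b::finite) code \<Rightarrow> real"
  where "success_prob N C =
    1 / of_nat CARD('m) *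
    (\<Sum>k\<in>UNIV. Re (trace (compose_code C N (matrix_unit k k) ** matrix_unit k k)))"

text \<open>
  The suprema are taken in the extended reals, where they are meaningful without a prior proof
  that the set of success probabilities is nonempty and bounded.
\<close>

definition opt_success ::
    "(('m::finite, 'a::finite, 'b::finite) code \<Rightarrow> bool) \<Rightarrow> ('a op \<Rightarrow> 'b op) \<Rightarrow> ereal"
  where "opt_success \<Omega> N = (SUP C\<in>{C. \<Omega> C}. ereal (success_prob N C))"

definition f_NS :: "('a::finite op \<Rightarrow> 'b::finite op) \<Rightarrow> 'm::finite itself \<Rightarrow> ereal"
  where "f_NS N _ = opt_success (\<lambda>C :: ('m, 'a, 'b) code. ns_code C) N"

definition f_NS_PPT :: "('a::finite op \<Rightarrow> 'b::finite op) \<Rightarrow> 'm::finite itself \<Rightarrow> ereal"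
  where "f_NS_PPT N _ = opt_success (\<lambda>C :: ('m, 'a, 'b) code. ns_code C \<and> ppt_code C) N"

definition is_maximum :: "'x::order set \<Rightarrow> 'x \<Rightarrow> bool"
  where "is_maximum S v \<longleftrightarrow> v \<in> S \<and> (\<forall>x\<in>S. x \<le> v)"

end

theory Submission
  imports Defs
begin

text \<open>
  From a code with Choi matrix \<open>Z\<close> take for \<open>F\<close> the transposed average of the blocks of \<open>Z\<close>
  at \<open>(a\<^sub>i, b\<^sub>o) = (k, k)\<close>, and for \<open>\<rho>\<close> the transposed normalised
  \<open>A\<^sub>o\<close> marginal.  Because \<open>B\<close> cannot signal to \<open>A\<close>, summing all the blocks of row \<open>k\<close> over
  \<open>b\<^sub>o\<close> gives \<open>\<rho> \<otimes> 1\<close> after averaging, so \<open>\<rho> \<otimes> 1 - F\<close> is an average of the blocks with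
  \<open>a\<^sub>i \<noteq> b\<^sub>o\<close>.  Conversely, a feasible pair gives the code whose Choi matrix is block
  diagonal in \<open>(a\<^sub>i, b\<^sub>o)\<close>, with blocks \<open>F\<^sup>T\<close> for \<open>a\<^sub>i = b\<^sub>o\<close> and
  \<open>(\<rho> \<otimes> 1 - F)\<^sup>T / (m - 1)\<close> otherwise.  The two value sets therefore coincide, and the
  maximum is attained because the feasible set is compact.
\<close>


section \<open>Positive semidefinite matrices\<close>

lemma inner_matrix_vector:
  "v \<bullet> (A *v v) = Re (\<Sum>p\<in>UNIV. \<Sum>q\<in>UNIV. cnj (v $ p) * A $ p $ q * v $ q)"
proof -
  have *: "x \<bullet> y = Re (cnj x * y)" for x y :: complex
    by (simp add: inner_complex_def)
  show ?thesis
    by (simp only: inner_vec_def * matrix_vector_mult_def vec_lambda_beta Re_sum[symmetric]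
        sum_distrib_left mult.assoc)
qed

lemma hermitian_iff: "hermitian A \<longleftrightarrow> (\<forall>i j. cnj (A $ i $ j) = A $ j $ i)"
  by (auto simp: hermitian_def adj_def map_matrix_def transpose_def vec_eq_iff)

text \<open>Test vectors become plain functions on the index type, so that quadratic forms can be
  handled as finite double sums, reindexed, and restricted to subsets of the indices.\<close>

lemma psd_iff:
  "psd A \<longleftrightarrow> hermitian A \<and>
    (\<forall>f. 0 \<le> Re (\<Sum>p\<in>UNIV. \<Sum>q\<in>UNIV. cnj (f p) * A $ p $ q * f q))"
proof -
  have "0 \<le> Re (\<Sum>p\<in>UNIV. \<Sum>q\<in>UNIV. cnj (f p) * A $ p $ q * f q)"
    if "\<forall>v. 0 \<le> v \<bullet> (A *v v)" for f
    using that[rule_format, of "\<chi> p. f p"] by (simp only: inner_matrix_vector vec_lambda_beta)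
  moreover have "0 \<le> v \<bullet> (A *v v)"
    if "\<forall>f. 0 \<le> Re (\<Sum>p\<in>UNIV. \<Sum>q\<in>UNIV. cnj (f p) * A $ p $ q * f q)" for v
    unfolding inner_matrix_vector using that by (rule spec)
  ultimately show ?thesis
    unfolding psd_def by blast
qed

lemma psd_quadratic_nonneg:
  assumes "psd A" shows "0 \<le> Re (\<Sum>p\<in>UNIV. \<Sum>q\<in>UNIV. cnj (f p) * A $ p $ q * f q)"
  using assms[unfolded psd_iff, THEN conjunct2, THEN spec, of f] .

lemma psd_zero: "psd 0"
  by (simp add: psd_iff hermitian_iff)

lemma psd_add: "psd A \<Longrightarrow> psd B \<Longrightarrow> psd (A + B)"
  by (simp add: psd_def hermitian_iff matrix_vector_mult_add_rdistrib inner_add_right)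

lemma psd_sum: "(\<And>i. i \<in> S \<Longrightarrow> psd (f i)) \<Longrightarrow> psd (\<Sum>i\<in>S. f i)"
  by (induction S rule: infinite_finite_induct) (simp_all add: psd_zero psd_add)

lemma psd_scaleR:
  assumes "0 \<le> c" and "psd A" shows "psd (c *\<^sub>R A)"
proof -
  have "0 \<le> Re (\<Sum>p\<in>UNIV. \<Sum>q\<in>UNIV. cnj (f p) * (c *\<^sub>R A) $ p $ q * f q)" for f
  proof -
    have "(\<Sum>p\<in>UNIV. \<Sum>q\<in>UNIV. cnj (f p) * (c *\<^sub>R A) $ p $ q * f q) =
        c *\<^sub>R (\<Sum>p\<in>UNIV. \<Sum>q\<in>UNIV. cnj (f p) * A $ p $ q * f q)"
      by (simp add: scaleR_sum_right)
    moreover have "0 \<le> Re (\<Sum>p\<in>UNIV. \<Sum>q\<in>UNIV. cnj (f p) * A $ p $ q * f q)"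
      by (rule psd_quadratic_nonneg[OF assms(2)])
    ultimately show ?thesis
      using assms(1) by (simp only: scaleR_complex.sel mult_nonneg_nonneg)
  qed
  then show ?thesis
    using assms by (simp add: psd_iff hermitian_iff)
qed

text \<open>The quadratic form of the transpose at \<open>f\<close> is the form of \<open>A\<close>
  at the conjugate of \<open>f\<close>.\<close>

lemma psd_transpose:
  assumes "psd A" shows "psd (transpose A)"
proof -
  have "0 \<le> Re (\<Sum>p\<in>UNIV. \<Sum>q\<in>UNIV. cnj (f p) * A $ q $ p * f q)" for f
  proof -
    have "(\<Sum>p\<in>UNIV. \<Sum>q\<in>UNIV. cnj (f p) * A $ q $ p * f q) =
        (\<Sum>q\<in>UNIV. \<Sum>p\<in>UNIV. cnj (cnj (f q)) * A $ q $ p * cnj (f p))"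
      by (subst sum.swap) (simp only: complex_cnj_cnj mult.assoc mult.commute mult.left_commute)
    then show ?thesis
      by (simp only: psd_quadratic_nonneg[OF assms])
  qed
  then show ?thesis
    using assms by (simp add: psd_iff hermitian_iff transpose_def)
qed

text \<open>The form of \<open>reorder h A\<close> at \<open>f\<close> is the form of
  \<open>A\<close> at the push-forward of \<open>f\<close> along \<open>h\<close>, whose value at
  \<open>p\<close> is the sum of \<open>f\<close> over the fibre of \<open>p\<close>. As
  \<open>h\<close> is arbitrary, this covers permutations of tensor factors as well as compressions
  to a diagonal block.\<close>

lemma psd_reorder:
  fixes h :: "'x::finite \<Rightarrow> 'n::finite"
  assumes "psd A" shows "psd (reorder h A)"
proof -
  have fibres: "(\<Sum>x\<in>UNIV. g x) = (\<Sum>p\<in>UNIV. \<Sum>x | h x = p. g x)" for g :: "'x \<Rightarrow> complex"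
    using sum.group[of UNIV UNIV h g] by simp
  have "0 \<le> Re (\<Sum>x\<in>UNIV. \<Sum>y\<in>UNIV. cnj (f x) * A $ h x $ h y * f y)" for f
  proof -
    let ?w = "\<lambda>p. \<Sum>x | h x = p. f x"
    have "(\<Sum>x\<in>UNIV. \<Sum>y\<in>UNIV. cnj (f x) * A $ h x $ h y * f y) =
        (\<Sum>x\<in>UNIV. \<Sum>q\<in>UNIV. \<Sum>y | h y = q. cnj (f x) * A $ h x $ h y * f y)"
      by (intro sum.cong refl) (rule fibres)
    also have "\<dots> = (\<Sum>x\<in>UNIV. \<Sum>q\<in>UNIV. cnj (f x) * A $ h x $ q * ?w q)"
      unfolding sum_distrib_left by (intro sum.cong refl) simp
    also have "\<dots> = (\<Sum>p\<in>UNIV. \<Sum>x | h x = p. \<Sum>q\<in>UNIV. cnj (f x) * A $ h x $ q * ?w q)"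
      by (rule fibres)
    also have "\<dots> = (\<Sum>p\<in>UNIV. \<Sum>x | h x = p. \<Sum>q\<in>UNIV. cnj (f x) * A $ p $ q * ?w q)"
      by (intro sum.cong refl) simp
    also have "\<dots> = (\<Sum>p\<in>UNIV. \<Sum>q\<in>UNIV. \<Sum>x | h x = p. cnj (f x) * A $ p $ q * ?w q)"
      by (intro sum.cong refl) (rule sum.swap)
    also have "\<dots> = (\<Sum>p\<in>UNIV. \<Sum>q\<in>UNIV. cnj (?w p) * A $ p $ q * ?w q)"
      by (simp only: cnj_sum sum_distrib_right)
    finally show ?thesis
      by (simp only: psd_quadratic_nonneg[OF assms])
  qed
  then show ?thesis
    using assms by (simp add: psd_iff hermitian_iff reorder_def)
qed

text \<open>Here \<open>g\<close> gives the label of the block containing an index and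
  \<open>h\<close> the position inside that block. The form at \<open>f\<close> splits into one form
  per label \<open>c\<close>, namely that of \<open>reorder h (A c)\<close> at \<open>f\<close> cut
  down to the indices labelled \<open>c\<close>.\<close>

lemma psd_block_diagonal:
  fixes A :: "'c::finite \<Rightarrow> 'x::finite op" and g :: "'n::finite \<Rightarrow> 'c" and h :: "'n \<Rightarrow> 'x"
  assumes "\<And>c. psd (A c)"
  shows "psd (\<chi> p q. if g p = g q then A (g p) $ h p $ h q else 0)"
proof -
  have "0 \<le> Re (\<Sum>p\<in>UNIV. \<Sum>q\<in>UNIV.
      cnj (f p) * (if g p = g q then A (g p) $ h p $ h q else 0) * f q)" (is "0 \<le> Re ?L") for f
  proof -
    let ?f = "\<lambda>c p. if g p = c then f p else 0"
    \<comment> \<open>A sum over labels is inserted in which only the label of \<open>p\<close>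
      contributes; it is then moved to the front.\<close>
    have "?L = (\<Sum>p\<in>UNIV. \<Sum>q\<in>UNIV. \<Sum>c\<in>UNIV. if c = g p then
        (if g q = c then cnj (f p) * A c $ h p $ h q * f q else 0) else 0)"
      by (intro sum.cong refl) auto
    also have "\<dots> = (\<Sum>p\<in>UNIV. \<Sum>q\<in>UNIV. \<Sum>c\<in>UNIV.
        cnj (?f c p) * reorder h (A c) $ p $ q * ?f c q)"
      by (intro sum.cong refl) (auto simp: reorder_def)
    also have "\<dots> = (\<Sum>p\<in>UNIV. \<Sum>c\<in>UNIV. \<Sum>q\<in>UNIV.
        cnj (?f c p) * reorder h (A c) $ p $ q * ?f c q)"
      by (intro sum.cong refl) (rule sum.swap)
    also have "\<dots> = (\<Sum>c\<in>UNIV. \<Sum>p\<in>UNIV. \<Sum>q\<in>UNIV.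
        cnj (?f c p) * reorder h (A c) $ p $ q * ?f c q)"
      by (rule sum.swap)
    finally have "Re ?L = (\<Sum>c\<in>UNIV. Re (\<Sum>p\<in>UNIV. \<Sum>q\<in>UNIV.
        cnj (?f c p) * reorder h (A c) $ p $ q * ?f c q))"
      by (simp only: Re_sum)
    moreover have "0 \<le> Re (\<Sum>p\<in>UNIV. \<Sum>q\<in>UNIV.
        cnj (?f c p) * reorder h (A c) $ p $ q * ?f c q)" for c
      by (rule psd_quadratic_nonneg[OF psd_reorder[OF assms]])
    ultimately show ?thesis
      by (simp only: sum_nonneg)
  qed
  then show ?thesis
    using assms by (auto simp: psd_iff hermitian_iff)
qed

lemma sum_quadratic_pair:
  fixes A :: "'n::finite op"
  assumes "i \<noteq> j"
  shows "(\<Sum>p\<in>UNIV. \<Sum>q\<in>UNIV. cnj ((\<lambda>p. if p = i then x else if p = j then y else 0) p) * A $ p $ q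
      * (\<lambda>p. if p = i then x else if p = j then y else 0) q) =
    cnj x * A $ i $ i * x + cnj x * A $ i $ j * y + cnj y * A $ j $ i * x + cnj y * A $ j $ j * y"
proof -
  let ?f = "\<lambda>p. if p = i then x else if p = j then y else 0"
  have *: "(\<Sum>p\<in>UNIV. g p) = g i + g j" if "\<And>p. p \<noteq> i \<Longrightarrow> p \<noteq> j \<Longrightarrow> g p = 0" for g :: "'n \<Rightarrow> complex"
  proof -
    have "sum g {i, j} = sum g UNIV"
      using that by (intro sum.mono_neutral_left) auto
    then show ?thesis using assms by simp
  qed
  have "(\<Sum>q\<in>UNIV. cnj (?f p) * A $ p $ q * ?f q) =
      cnj (?f p) * A $ p $ i * x + cnj (?f p) * A $ p $ j * y" for p
    by (subst *) (use assms in auto)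
  then have "(\<Sum>p\<in>UNIV. \<Sum>q\<in>UNIV. cnj (?f p) * A $ p $ q * ?f q) =
      (\<Sum>p\<in>UNIV. cnj (?f p) * A $ p $ i * x + cnj (?f p) * A $ p $ j * y)"
    by (intro sum.cong refl)
  also have "\<dots> = cnj x * A $ i $ i * x + cnj x * A $ i $ j * y + cnj y * A $ j $ i * x
      + cnj y * A $ j $ j * y"
    by (subst *) (use assms in auto)
  finally show ?thesis .
qed

text \<open>A diagonal entry is the compression of the matrix to a one-point index type.\<close>

lemma psd_diagonal_nonneg:
  assumes "psd A" shows "0 \<le> Re (A $ i $ i)"
proof -
  have "psd (reorder (\<lambda>_ :: unit. i) A)"
    by (rule psd_reorder[OF assms])
  from psd_quadratic_nonneg[OF this, of "\<lambda>_. 1"] show ?thesis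
    by (simp add: UNIV_unit reorder_def)
qed

text \<open>Positivity on a vector supported on \<open>i\<close> and \<open>j\<close>, with suitable
  phases, bounds twice the modulus of the entry by the sum of two diagonal entries. This yields both
  the boundedness of the feasible set and the vanishing of positive matrices of trace zero.\<close>

lemma psd_norm_entry_le_trace:
  assumes "psd A" shows "norm (A $ i $ j) \<le> Re (trace A)"
proof -
  have diag: "0 \<le> Re (A $ k $ k)" for k
    using assms by (rule psd_diagonal_nonneg)
  have tr: "Re (trace A) = (\<Sum>k\<in>UNIV. Re (A $ k $ k))"
    by (simp add: trace_def)
  have herm: "cnj (A $ k $ l) = A $ l $ k" for k l
    using assms by (simp add: psd_def hermitian_iff)
  show ?thesis
  proof (cases "i = j")
    case True
    have "Im (A $ i $ i) = 0"
      using arg_cong[OF herm[of i i], of Im] by simp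
    then have "norm (A $ i $ i) = Re (A $ i $ i)"
      using diag[of i] by (simp add: cmod_def)
    also have "\<dots> \<le> Re (trace A)"
      unfolding tr using diag by (intro member_le_sum) auto
    finally show ?thesis using True by simp
  next
    case False
    \<comment> \<open>The test vector has entries \<open>x\<close> at \<open>i\<close> and 1 at
      \<open>j\<close>; this phase turns each of the two cross terms into minus the modulus of the
      entry.\<close>
    define x where "x = - sgn (A $ i $ j)"
    have x: "cnj x * A $ i $ j = - of_real (norm (A $ i $ j))"
    proof (cases "A $ i $ j = 0")
      case False
      have "cnj (A $ i $ j) * A $ i $ j = of_real (norm (A $ i $ j)) * of_real (norm (A $ i $ j))"
        by (metis complex_norm_square mult.commute of_real_power power2_eq_square)
      then show ?thesis using False by (simp add: x_def sgn_eq)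
    qed (simp add: x_def)
    have y: "A $ j $ i * x = - of_real (norm (A $ i $ j))"
      using arg_cong[OF x, of cnj] by (simp add: herm mult.commute)
    have xx: "cnj x * x = of_real ((norm x)\<^sup>2)"
      by (metis complex_norm_square mult.commute)
    \<comment> \<open>Only an inequality holds, because \<open>sgn\<close> is 0 when the entry
      vanishes.\<close>
    have "norm x \<le> 1"
      by (simp add: x_def norm_sgn)
    then have nx: "(norm x)\<^sup>2 \<le> 1"
      by (simp add: power_le_one)
    have "0 \<le> Re (cnj x * A $ i $ i * x + cnj x * A $ i $ j * 1 + cnj 1 * A $ j $ i * x
        + cnj 1 * A $ j $ j * 1)"
      unfolding sum_quadratic_pair[OF False, symmetric] by (rule psd_quadratic_nonneg[OF assms])
    also have "cnj x * A $ i $ i * x = (cnj x * x) * A $ i $ i"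
      by (simp add: mult_ac)
    finally have "0 \<le> (norm x)\<^sup>2 * Re (A $ i $ i) - norm (A $ i $ j) - norm (A $ i $ j) + Re (A $ j $ j)"
      by (simp add: x y xx)
    moreover have "(norm x)\<^sup>2 * Re (A $ i $ i) \<le> 1 * Re (A $ i $ i)"
      using nx diag by (intro mult_right_mono)
    moreover have "Re (A $ i $ i) + Re (A $ j $ j) \<le> Re (trace A)"
    proof -
      have "(\<Sum>k\<in>{i, j}. Re (A $ k $ k)) \<le> Re (trace A)"
        unfolding tr using diag by (intro sum_mono2) auto
      then show ?thesis using False by simp
    qed
    ultimately show ?thesis
      using diag[of i] diag[of j] by linarith
  qed
qed


lemma psd_trace_zero:
  assumes "psd A" and "trace A = 0" shows "A = 0"
  using psd_norm_entry_le_trace[OF assms(1)] assms(2) by (simp add: vec_eq_iff)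

section \<open>Identities for traces, tensor products and partial transposes\<close>

lemma sum_UNIV_prod:
  "(\<Sum>p\<in>(UNIV :: ('a::finite \<times> 'b::finite) set). f p) = (\<Sum>a\<in>UNIV. \<Sum>b\<in>UNIV. f (a, b))"
  by (simp add: sum.cartesian_product' flip: UNIV_Times_UNIV)

lemma mscale_of_real: "mscale (of_real c) A = c *\<^sub>R A"
  by (simp add: mscale_def map_matrix_def vec_eq_iff) (simp add: scaleR_conv_of_real)

lemma trace_scaleR: "trace (c *\<^sub>R (A :: 'n::finite op)) = c *\<^sub>R trace A"
  by (simp add: trace_def scaleR_sum_right)

lemma trace_transpose: "trace (transpose A) = trace A"
  by (simp add: trace_def transpose_def)

lemma trace_kron_mat: "trace ((\<rho> :: 'a::finite op) \<otimes> (mat 1 :: 'b::finite op)) = of_nat CARD('b) * trace \<rho>"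
  by (simp add: trace_def kron_def mat_def sum_UNIV_prod sum_distrib_left)

lemma trace_ptrace_fst: "trace (ptrace_fst F) = trace F"
  by (simp add: trace_def marginal_def sum_UNIV_prod) (rule sum.swap)

lemma transpose_kron: "transpose (A \<otimes> B) = transpose A \<otimes> transpose B"
  by (simp add: transpose_def kron_def vec_eq_iff)

lemma ptranspose_transpose: "ptranspose (transpose A) = transpose (ptranspose A)"
  by (simp add: ptranspose_def transpose_def vec_eq_iff)

lemma transpose_diff: "transpose (A - B) = transpose A - transpose B"
  by (simp add: transpose_def vec_eq_iff)

lemma ptranspose_diff: "ptranspose (A - B) = ptranspose A - ptranspose B"
  by (simp add: ptranspose_def vec_eq_iff)

lemma ptranspose_scaleR: "ptranspose (c *\<^sub>R A) = c *\<^sub>R ptranspose A"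
  by (simp add: ptranspose_def vec_eq_iff)

lemma ptranspose_sum: "ptranspose (\<Sum>i\<in>S. f i) = (\<Sum>i\<in>S. ptranspose (f i))"
  by (simp add: ptranspose_def vec_eq_iff)

lemma ptranspose_kron_mat: "ptranspose (A \<otimes> mat 1) = A \<otimes> mat 1"
  by (auto simp: ptranspose_def kron_def mat_def vec_eq_iff)

lemma ptrace_fst_nth: "ptrace_fst F $ b $ b' = (\<Sum>a\<in>UNIV. F $ (a, b) $ (a, b'))"
  by (simp add: marginal_def)

section \<open>Compactness of the feasible set\<close>

text \<open>The constraints are divided so that the no-signalling program uses this predicate alone,
  while the other program intersects it with the closed condition
  \<open>ppt_feasible\<close>.\<close>

definition ns_feasible :: "nat \<Rightarrow> ('a::finite \<times> 'b::finite) op \<Rightarrow> 'a op \<Rightarrow> bool"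
  where "ns_feasible m F \<rho> \<longleftrightarrow> hermitian F \<and> hermitian \<rho> \<and> 0 \<preceq> F \<and> F \<preceq> \<rho> \<otimes> mat 1 \<and>
    trace \<rho> = 1 \<and> ptrace_fst F = mscale (1 / of_nat m) (mat 1)"

definition ppt_feasible :: "('a::finite \<times> 'b::finite) op \<Rightarrow> 'a op \<Rightarrow> bool"
  where "ppt_feasible F \<rho> \<longleftrightarrow> 0 \<preceq> ptranspose F \<and> ptranspose F \<preceq> \<rho> \<otimes> mat 1"

text \<open>Hermiticity and the inequality for each fixed test vector are closed conditions, and the
  set is their intersection.\<close>

lemma closed_psd: "closed {A :: 'n::finite op. psd A}"
  unfolding psd_iff hermitian_iff
  by (intro closed_Collect_conj closed_Collect_all closed_Collect_eq closed_Collect_le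
      continuous_intros)

lemma closed_psd_Collect:
  fixes f :: "'x::topological_space \<Rightarrow> 'n::finite op"
  assumes "continuous_on UNIV f" shows "closed {x. psd (f x)}"
  using closed_vimage[OF closed_psd assms] by (simp add: vimage_def)

lemma continuous_on_kron_mat [continuous_intros]:
  fixes f :: "'x::topological_space \<Rightarrow> 'a::finite op"
  assumes "continuous_on S f"
  shows "continuous_on S (\<lambda>x. f x \<otimes> (mat 1 :: 'b::finite op))"
  unfolding kron_def by (intro continuous_intros assms)

lemma continuous_on_ptranspose [continuous_intros]:
  fixes f :: "'x::topological_space \<Rightarrow> ('a::finite \<times> 'b::finite) op"
  assumes "continuous_on S f"
  shows "continuous_on S (\<lambda>x. ptranspose (f x))"
  unfolding ptranspose_def by (intro continuous_intros assms)

lemma continuous_on_ptrace_fst [continuous_intros]: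
  fixes f :: "'x::topological_space \<Rightarrow> ('a::finite \<times> 'b::finite) op"
  assumes "continuous_on S f"
  shows "continuous_on S (\<lambda>x. ptrace_fst (f x))"
  unfolding marginal_def by (intro continuous_intros assms)

lemma continuous_on_trace [continuous_intros]:
  fixes f :: "'x::topological_space \<Rightarrow> 'n::finite op"
  assumes "continuous_on S f"
  shows "continuous_on S (\<lambda>x. trace (f x))"
  unfolding trace_def by (intro continuous_intros assms)

lemma continuous_on_matrix_mult_left [continuous_intros]:
  fixes f :: "'x::topological_space \<Rightarrow> 'n::finite op"
  assumes "continuous_on S f"
  shows "continuous_on S (\<lambda>x. J ** f x)"
  unfolding matrix_matrix_mult_def by (intro continuous_intros assms)

lemma norm_op_le:
  fixes A :: "'n::finite op"
  assumes "\<And>i j. norm (A $ i $ j) \<le> c"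
  shows "norm A \<le> of_nat CARD('n) * (of_nat CARD('n) * c)"
proof -
  have *: "norm v \<le> (\<Sum>i\<in>UNIV. norm (v $ i))" for v :: "'d::real_normed_vector ^ 'n"
    unfolding norm_vec_def by (rule L2_set_le_sum) simp
  have "norm A \<le> (\<Sum>i\<in>UNIV. norm (A $ i))"
    by (rule *)
  also have "\<dots> \<le> (\<Sum>i\<in>UNIV. \<Sum>j\<in>UNIV. norm (A $ i $ j))"
    by (intro sum_mono) (rule *)
  also have "\<dots> \<le> (\<Sum>i\<in>(UNIV :: 'n set). \<Sum>j\<in>(UNIV :: 'n set). c)"
    by (intro sum_mono assms)
  finally show ?thesis by simp
qed

lemma closed_ns_feasible:
  "closed {x. ns_feasible m (fst x :: ('a::finite \<times> 'b::finite) op) (snd x)}"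
  unfolding ns_feasible_def loewner_le_def hermitian_iff
  by (intro closed_Collect_conj closed_Collect_all closed_Collect_eq closed_psd_Collect
      continuous_intros)

lemma closed_ppt_feasible:
  "closed {x. ppt_feasible (fst x :: ('a::finite \<times> 'b::finite) op) (snd x)}"
  unfolding ppt_feasible_def loewner_le_def
  by (intro closed_Collect_conj closed_psd_Collect continuous_intros)

text \<open>Since \<rho> has trace 1, the trace of \<open>\<rho> \<otimes> mat 1\<close> is the
  dimension of B, and \<open>F\<close> lies below it. Traces of positive matrices bound their
  entries, and \<open>\<rho> \<otimes> mat 1\<close> is positive as the sum of \<open>F\<close> and
  the positive difference.\<close>

lemma ns_feasible_norm_le:
  fixes F :: "('a::finite \<times> 'b::finite) op"
  assumes "ns_feasible m F \<rho>"
  shows "norm (F $ p $ q) \<le> of_nat CARD('b)" and "norm (\<rho> $ i $ j) \<le> of_nat CARD('b)"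
proof -
  let ?R = "\<rho> \<otimes> (mat 1 :: 'b op)"
  have F: "psd F" and R: "psd (?R - F)"
    using assms by (simp_all add: ns_feasible_def loewner_le_def)
  have tr: "trace ?R = of_nat CARD('b)"
    using assms by (simp add: trace_kron_mat ns_feasible_def)
  have "0 \<le> Re (trace (?R - F))"
    using R psd_norm_entry_le_trace norm_ge_zero order_trans by blast
  then have "Re (trace F) \<le> of_nat CARD('b)"
    by (simp add: trace_sub tr)
  then show "norm (F $ p $ q) \<le> of_nat CARD('b)"
    using psd_norm_entry_le_trace[OF F] order_trans by blast
  have "psd ?R"
    using psd_add[OF R F] by simp
  \<comment> \<open>The same arbitrary basis index of B is taken on both sides, so that the identity
    contributes the factor 1 and the entry of \<rho> remains.\<close>
  from psd_norm_entry_le_trace[OF this, of "(i, undefined)" "(j, undefined)", unfolded tr]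
  show "norm (\<rho> $ i $ j) \<le> of_nat CARD('b)"
    by (simp add: kron_def mat_def)
qed

lemma compact_ns_feasible:
  "compact {x. ns_feasible m (fst x :: ('a::finite \<times> 'b::finite) op) (snd x)}"
proof -
  let ?n = "of_nat CARD('a \<times> 'b) * (of_nat CARD('a \<times> 'b) * of_nat CARD('b)) :: real"
  let ?n' = "of_nat CARD('a) * (of_nat CARD('a) * of_nat CARD('b)) :: real"
  have "norm x \<le> ?n + ?n'"
    if "ns_feasible m (fst x :: ('a \<times> 'b) op) (snd x)" for x
  proof -
    have "norm (fst x) \<le> ?n" and "norm (snd x) \<le> ?n'"
      using ns_feasible_norm_le[OF that] by (blast intro: norm_op_le)+
    then show ?thesis
      using norm_Pair_le[of "fst x" "snd x"] by simp
  qed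
  then have "bounded {x. ns_feasible m (fst x :: ('a \<times> 'b) op) (snd x)}"
    unfolding bounded_iff by blast
  with closed_ns_feasible show ?thesis
    by (simp add: compact_eq_bounded_closed)
qed

lemma psd_mat: "psd (mat 1)"
proof -
  have "hermitian (mat 1)"
    by (simp add: hermitian_iff mat_def)
  then show ?thesis
    by (simp add: psd_def)
qed

text \<open>The witness is the maximally mixed \<rho> together with \<open>F\<close> equal to
  \<open>\<rho> \<otimes> mat 1\<close> divided by \<open>m\<close>. This \<open>F\<close> is its
  own partial transpose, so the PPT constraints coincide with the others.\<close>

lemma feasible_nonempty:
  assumes "m \<ge> 1"
  shows "\<exists>(F :: ('a::finite \<times> 'b::finite) op) \<rho>. ns_feasible m F \<rho> \<and> ppt_feasible F \<rho>"
proof -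
  define \<rho> :: "'a op" where "\<rho> = (1 / of_nat CARD('a)) *\<^sub>R mat 1"
  define R where "R = \<rho> \<otimes> (mat 1 :: 'b op)"
  define F where "F = (1 / of_nat m) *\<^sub>R R"
  have R: "R = (1 / of_nat CARD('a)) *\<^sub>R mat 1"
    by (simp add: R_def \<rho>_def kron_def mat_def vec_eq_iff prod_eq_iff)
  have psd_R: "psd R" and "psd \<rho>"
    by (simp_all add: R \<rho>_def psd_scaleR psd_mat)
  have psd_F: "psd F"
    using psd_R by (simp add: F_def psd_scaleR)
  have "R - F = (1 - 1 / of_nat m) *\<^sub>R R"
    by (simp add: F_def algebra_simps)
  then have psd_RF: "psd (R - F)"
    using assms psd_R by (simp add: psd_scaleR)
  have pt: "ptranspose F = F"
    by (simp add: F_def R_def ptranspose_scaleR ptranspose_kron_mat)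
  have tr: "trace \<rho> = 1"
    by (simp add: \<rho>_def trace_scaleR trace_I) (simp add: scaleR_conv_of_real)
  have "ptrace_fst F = (1 / of_nat m) *\<^sub>R mat 1"
    by (simp add: vec_eq_iff ptrace_fst_nth F_def R) (simp add: mat_def scaleR_conv_of_real)
  then have "ptrace_fst F = mscale (1 / of_nat m) (mat 1)"
    by (simp flip: mscale_of_real)
  with psd_F psd_RF \<open>psd \<rho>\<close> tr have "ns_feasible m F \<rho> \<and> ppt_feasible F \<rho>"
    by (simp add: ns_feasible_def ppt_feasible_def loewner_le_def pt R_def psd_def)
  then show ?thesis by blast
qed

section \<open>From codes to feasible pairs\<close>

text \<open>The block belongs to message \<open>k\<close> being sent and \<open>l\<close> being
  decoded. Its factors are put in the order used by \<open>choi N\<close>.\<close>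

definition message_block :: "'m \<Rightarrow> 'm \<Rightarrow> ('m::finite, 'a::finite, 'b::finite) code_choi \<Rightarrow> ('a \<times> 'b) op"
  where "message_block k l Z = reorder (\<lambda>(a, b). ((k, b), (a, l))) Z"

text \<open>The transpose turns the entrywise pairing of \<open>choi N\<close> with a block, which
  the composition produces, into the trace of a product.\<close>

definition code_F :: "('m::finite, 'a::finite, 'b::finite) code_choi \<Rightarrow> ('a \<times> 'b) op"
  where "code_F Z = (1 / of_nat CARD('m)) *\<^sub>R transpose (\<Sum>k\<in>UNIV. message_block k k Z)"

text \<open>The normalisation is the trace of \<open>Z\<close> for a code, whose marginal on A_i B_i
  is the identity.\<close>

definition code_rho :: "('m::finite, 'a::finite, 'b::finite) code_choi \<Rightarrow> 'a op"
  where "code_rho Z = (1 / of_nat (CARD('m) * CARD('b))) *\<^sub>R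
    transpose (\<Sum>k\<in>UNIV. reorder (Pair k) (marg_AiAo Z))"

lemma message_block_nth: "message_block k l Z $ (a, b) $ (a', b') = Z $ ((k, b), (a, l)) $ ((k, b'), (a', l))"
  by (simp add: message_block_def reorder_def)

lemma marg_AiBi_nth: "marg_AiBi Z $ (k, b) $ (k', b') =
    (\<Sum>l\<in>UNIV. \<Sum>a\<in>UNIV. Z $ ((k, b), (a, l)) $ ((k', b'), (a, l)))"
  by (simp add: marg_AiBi_def marginal_def sum_UNIV_prod) (rule sum.swap)

lemma marg_AiBiBo_nth: "marg_AiBiBo Z $ (k, b, l) $ (k', b', l') =
    (\<Sum>a\<in>UNIV. Z $ ((k, b), (a, l)) $ ((k', b'), (a, l')))"
  by (simp add: marg_AiBiBo_def marginal_def)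

lemma marg_BiBo_nth: "marg_BiBo Z $ (b, l) $ (b', l') =
    (\<Sum>k\<in>UNIV. \<Sum>a\<in>UNIV. Z $ ((k, b), (a, l)) $ ((k, b'), (a, l')))"
  by (simp add: marg_BiBo_def marginal_def sum_UNIV_prod)

lemma marg_BiAiAo_nth: "marg_BiAiAo Z $ (b, k, a) $ (b', k', a') =
    (\<Sum>l\<in>UNIV. Z $ ((k, b), (a, l)) $ ((k', b'), (a', l)))"
  by (simp add: marg_BiAiAo_def marginal_def)

lemma marg_AiAo_nth: "marg_AiAo Z $ (k, a) $ (k', a') =
    (\<Sum>b\<in>UNIV. \<Sum>l\<in>UNIV. Z $ ((k, b), (a, l)) $ ((k', b), (a', l)))"
  by (simp add: marg_AiAo_def marginal_def sum_UNIV_prod)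

section \<open>The success probability as a linear functional of \<open>code_F\<close>\<close>

lemma compose_choi_diagonal:
  fixes C :: "('m::finite, 'a::finite, 'b::finite) code"
  shows "compose_choi C N $ (k, k) $ (k, k) =
    (\<Sum>p\<in>UNIV. \<Sum>q\<in>UNIV. choi N $ q $ p * message_block k k (choi C) $ q $ p)"
proof -
  have "compose_choi C N $ (k, k) $ (k, k) =
      (\<Sum>a\<in>UNIV. \<Sum>b\<in>UNIV. \<Sum>k'\<in>UNIV. \<Sum>b'\<in>UNIV. \<Sum>a'\<in>UNIV. \<Sum>l'\<in>UNIV.
        choi N $ (a', b') $ (a, b) * (if (k, k) = (k', l') then 1 else 0) *
        choi C $ ((k', b'), (a', l')) $ ((k, b), (a, k)))"
    by (simp add: compose_choi_def marginal_def reorder_def kron_def matrix_matrix_mult_def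
        transpose_def mat_def sum_UNIV_prod)
  \<comment> \<open>The identity on A_i B_o forces the inner message indices to be \<open>k\<close>,
    so only the block at \<open>(k, k)\<close> survives.\<close>
  also have "\<dots> = (\<Sum>a\<in>UNIV. \<Sum>b\<in>UNIV. \<Sum>k'\<in>UNIV. if k' = k then \<Sum>b'\<in>UNIV. \<Sum>a'\<in>UNIV.
      \<Sum>l'\<in>UNIV. if l' = k then choi N $ (a', b') $ (a, b) *
        choi C $ ((k', b'), (a', l')) $ ((k, b), (a, k)) else 0 else 0)"
    by (intro sum.cong refl) (auto simp: if_distrib if_distribR cong: if_cong)
  also have "\<dots> = (\<Sum>a\<in>UNIV. \<Sum>b\<in>UNIV. \<Sum>b'\<in>UNIV. \<Sum>a'\<in>UNIV.
      choi N $ (a', b') $ (a, b) * choi C $ ((k, b'), (a', k)) $ ((k, b), (a, k)))"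
    by simp
  also have "\<dots> = (\<Sum>a\<in>UNIV. \<Sum>b\<in>UNIV. \<Sum>a'\<in>UNIV. \<Sum>b'\<in>UNIV.
      choi N $ (a', b') $ (a, b) * choi C $ ((k, b'), (a', k)) $ ((k, b), (a, k)))"
    by (intro sum.cong refl) (rule sum.swap)
  finally show ?thesis
    by (simp add: sum_UNIV_prod message_block_nth)
qed

lemma trace_mult_transpose:
  "trace (A ** transpose B) = (\<Sum>p\<in>UNIV. \<Sum>q\<in>UNIV. A $ q $ p * B $ q $ p)"
  by (subst sum.swap) (simp add: trace_def matrix_matrix_mult_def transpose_def)

lemma matrix_mult_scaleR: "A ** (c *\<^sub>R B) = c *\<^sub>R (A ** (B :: 'n::finite op))"
  by (simp add: matrix_matrix_mult_def vec_eq_iff scaleR_sum_right)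

lemma trace_mult_matrix_unit: "trace (A ** matrix_unit k k) = A $ k $ k"
proof -
  have "trace (A ** matrix_unit k k) = (\<Sum>i\<in>UNIV. \<Sum>j\<in>UNIV. if j = k then if i = k then A $ i $ j else 0 else 0)"
    unfolding trace_def matrix_matrix_mult_def matrix_unit_def vec_lambda_beta
    by (intro sum.cong refl) auto
  then show ?thesis by simp
qed

text \<open>Sending \<open>k\<close> and decoding \<open>k\<close> reads off a single diagonal entry
  of the Choi matrix of the composition, which pairs \<open>choi N\<close> with the block at
  \<open>(k, k)\<close>. Averaging over \<open>k\<close> assembles \<open>code_F\<close>.\<close>

lemma success_prob_eq:
  fixes C :: "('m::finite, 'a::finite, 'b::finite) code"
  shows "success_prob N C = Re (trace (choi N ** code_F (choi C)))"
proof -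
  have "of_choi J (matrix_unit k k) $ k $ k = J $ (k, k) $ (k, k)" for J :: "('m \<times> 'm) op" and k
  proof -
    have "of_choi J (matrix_unit k k) $ k $ k =
        (\<Sum>i\<in>UNIV. \<Sum>j\<in>UNIV. if j = k then if i = k then J $ (i, k) $ (j, k) else 0 else 0)"
      unfolding of_choi_nth matrix_unit_def vec_lambda_beta by (intro sum.cong refl) auto
    then show ?thesis by simp
  qed
  then have "success_prob N C = 1 / of_nat CARD('m) * (\<Sum>k\<in>UNIV. Re (\<Sum>p\<in>UNIV. \<Sum>q\<in>UNIV.
      choi N $ q $ p * message_block k k (choi C) $ q $ p))"
    unfolding success_prob_def compose_code_def trace_mult_matrix_unit
    by (simp only: compose_choi_diagonal)
  also have "(\<Sum>k\<in>UNIV. Re (\<Sum>p\<in>UNIV. \<Sum>q\<in>UNIV.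
      choi N $ q $ p * message_block k k (choi C) $ q $ p)) =
      Re (trace (choi N ** transpose (\<Sum>k\<in>UNIV. message_block k k (choi C))))"
  proof -
    have "trace (choi N ** transpose (\<Sum>k\<in>UNIV. message_block k k (choi C))) =
        (\<Sum>p\<in>UNIV. \<Sum>q\<in>UNIV. \<Sum>k\<in>UNIV. choi N $ q $ p * message_block k k (choi C) $ q $ p)"
      unfolding trace_mult_transpose sum_component sum_distrib_left ..
    also have "\<dots> = (\<Sum>p\<in>UNIV. \<Sum>k\<in>UNIV. \<Sum>q\<in>UNIV. choi N $ q $ p * message_block k k (choi C) $ q $ p)"
      by (intro sum.cong refl) (rule sum.swap)
    also have "\<dots> = (\<Sum>k\<in>UNIV. \<Sum>p\<in>UNIV. \<Sum>q\<in>UNIV. choi N $ q $ p * message_block k k (choi C) $ q $ p)"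
      by (rule sum.swap)
    finally show ?thesis by (simp only: Re_sum)
  qed
  finally show ?thesis
    by (simp only: code_F_def matrix_mult_scaleR trace_scaleR scaleR_complex.sel)
qed

text \<open>This exhibits the slack in the upper bound on \<open>F\<close> as a nonnegative
  combination of blocks, so that both this bound and its partially transposed version reduce to
  positivity of single blocks.\<close>

lemma kron_mat_minus_code_F:
  fixes Z :: "('m::finite, 'a::finite, 'b::finite) code_choi"
  assumes "marg_BiAiAo Z = mscale (1 / of_nat CARD('b)) (mat 1) \<otimes> marg_AiAo Z"
  shows "code_rho Z \<otimes> mat 1 - code_F Z =
    (1 / of_nat CARD('m)) *\<^sub>R transpose (\<Sum>k\<in>UNIV. \<Sum>l\<in>- {k}. message_block k l Z)"
proof -
  have blocks: "(\<Sum>l\<in>UNIV. message_block k l Z $ (a, b) $ (a', b')) =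
      (if b = b' then 1 / of_nat CARD('b) else 0) * marg_AiAo Z $ (k, a) $ (k, a')" for k a b a' b'
  proof -
    have "(\<Sum>l\<in>UNIV. message_block k l Z $ (a, b) $ (a', b')) = marg_BiAiAo Z $ (b, k, a) $ (b', k, a')"
      by (simp add: message_block_nth marg_BiAiAo_nth)
    also have "\<dots> = (if b = b' then 1 / of_nat CARD('b) else 0) * marg_AiAo Z $ (k, a) $ (k, a')"
      unfolding assms by (simp add: kron_def mscale_def mat_def map_matrix_def)
    finally show ?thesis .
  qed
  have split: "(\<Sum>l\<in>- {k}. f l) = (\<Sum>l\<in>UNIV. f l) - f k" for f :: "'m \<Rightarrow> complex" and k
    by (subst sum.remove[of UNIV k]) (simp_all add: Compl_eq_Diff_UNIV)
  have "(code_rho Z \<otimes> mat 1 - code_F Z) $ (a, b) $ (a', b') =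
      ((1 / of_nat CARD('m)) *\<^sub>R transpose (\<Sum>k\<in>UNIV. \<Sum>l\<in>- {k}. message_block k l Z)) $ (a, b) $ (a', b')"
    for a b a' b'
  proof -
    have "(\<Sum>k\<in>UNIV. \<Sum>l\<in>- {k}. message_block k l Z) $ (a', b') $ (a, b) =
        (\<Sum>k\<in>UNIV. (if b = b' then 1 / of_nat CARD('b) else 0) * marg_AiAo Z $ (k, a') $ (k, a)) -
        (\<Sum>k\<in>UNIV. message_block k k Z $ (a', b') $ (a, b))"
      by (auto simp: sum_component split blocks sum_subtractf)
    then show ?thesis
      by (simp add: code_rho_def code_F_def kron_def transpose_def mat_def reorder_def
          sum_distrib_left[symmetric])
        (simp add: scaleR_conv_of_real field_simps)
  qed
  then show ?thesis
    by (simp add: vec_eq_iff)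
qed

text \<open>The sums are reordered until the A_i B_i marginal appears, whose trace is the number of
  messages times the dimension of B.\<close>

lemma trace_code_rho:
  fixes Z :: "('m::finite, 'a::finite, 'b::finite) code_choi"
  assumes "marg_AiBi Z = mat 1"
  shows "trace (code_rho Z) = 1"
proof -
  have "trace (\<Sum>k\<in>UNIV. reorder (Pair k) (marg_AiAo Z)) =
      (\<Sum>a\<in>UNIV. \<Sum>k\<in>UNIV. \<Sum>b\<in>UNIV. \<Sum>l\<in>UNIV. Z $ ((k, b), (a, l)) $ ((k, b), (a, l)))"
    by (simp add: trace_def reorder_def marg_AiAo_nth)
  also have "\<dots> = (\<Sum>k\<in>UNIV. \<Sum>a\<in>UNIV. \<Sum>b\<in>UNIV. \<Sum>l\<in>UNIV. Z $ ((k, b), (a, l)) $ ((k, b), (a, l)))"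
    by (rule sum.swap)
  also have "\<dots> = (\<Sum>k\<in>UNIV. \<Sum>b\<in>UNIV. \<Sum>a\<in>UNIV. \<Sum>l\<in>UNIV. Z $ ((k, b), (a, l)) $ ((k, b), (a, l)))"
    by (intro sum.cong refl) (rule sum.swap)
  also have "\<dots> = (\<Sum>k\<in>UNIV. \<Sum>b\<in>UNIV. marg_AiBi Z $ (k, b) $ (k, b))"
    unfolding marg_AiBi_nth by (intro sum.cong refl) (rule sum.swap)
  also have "\<dots> = of_nat (CARD('m) * CARD('b))"
    by (simp add: assms mat_def)
  finally show ?thesis
    by (simp add: code_rho_def trace_scaleR trace_transpose) (simp add: scaleR_conv_of_real)
qed

text \<open>Because A cannot signal to B, tracing A_o out of the block at \<open>(k, k)\<close>
  leaves 1/m times the B_i B_o marginal at \<open>k\<close>, with no dependence on the message sent.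
  Summing over \<open>k\<close> then traces out B_o completely.\<close>

lemma ptrace_code_F:
  fixes Z :: "('m::finite, 'a::finite, 'b::finite) code_choi"
  assumes "marg_AiBi Z = mat 1"
    and "marg_AiBiBo Z = mscale (1 / of_nat CARD('m)) (mat 1) \<otimes> marg_BiBo Z"
  shows "ptrace_fst (code_F Z) = mscale (1 / of_nat CARD('m)) (mat 1)"
proof -
  have marg: "(\<Sum>a\<in>UNIV. Z $ ((k, b), (a, k)) $ ((k, b'), (a, k))) =
      1 / of_nat CARD('m) * marg_BiBo Z $ (b, k) $ (b', k)" for k b b'
  proof -
    have "(\<Sum>a\<in>UNIV. Z $ ((k, b), (a, k)) $ ((k, b'), (a, k))) = marg_AiBiBo Z $ (k, b, k) $ (k, b', k)"
      by (simp add: marg_AiBiBo_nth)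
    also have "\<dots> = 1 / of_nat CARD('m) * marg_BiBo Z $ (b, k) $ (b', k)"
      unfolding assms(2) by (simp add: kron_def mscale_def mat_def map_matrix_def)
    finally show ?thesis .
  qed
  \<comment> \<open>Both sides are the B_i marginal of \<open>Z\<close>, reached by tracing out A_i
    and B_o in either order.\<close>
  have "(\<Sum>k\<in>UNIV. marg_BiBo Z $ (b, k) $ (b', k)) = (\<Sum>k\<in>UNIV. marg_AiBi Z $ (k, b) $ (k, b'))" for b b'
    unfolding marg_BiBo_nth marg_AiBi_nth by (rule sum.swap)
  then have total: "(\<Sum>k\<in>UNIV. marg_BiBo Z $ (b, k) $ (b', k)) = (if b = b' then of_nat CARD('m) else 0)" for b b'
    by (simp add: assms(1) mat_def)
  have "ptrace_fst (code_F Z) $ b $ b' = (1 / of_nat CARD('m)) *\<^sub>R mat 1 $ b $ b'" for b b'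
  proof -
    have "ptrace_fst (code_F Z) $ b $ b' = (1 / of_nat CARD('m)) *\<^sub>R
        (\<Sum>a\<in>UNIV. \<Sum>k\<in>UNIV. Z $ ((k, b'), (a, k)) $ ((k, b), (a, k)))"
      by (simp add: ptrace_fst_nth code_F_def transpose_def message_block_nth scaleR_sum_right)
    also have "\<dots> = (1 / of_nat CARD('m)) *\<^sub>R
        (\<Sum>k\<in>UNIV. 1 / of_nat CARD('m) * marg_BiBo Z $ (b', k) $ (b, k))"
      by (subst sum.swap) (simp only: marg)
    also have "\<dots> = (1 / of_nat CARD('m)) *\<^sub>R mat 1 $ b $ b'"
      unfolding sum_distrib_left[symmetric] total by (simp add: mat_def)
    finally show ?thesis .
  qed
  then have "ptrace_fst (code_F Z) = (1 / of_nat CARD('m)) *\<^sub>R mat 1"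
    by (simp add: vec_eq_iff)
  then show ?thesis
    by (simp flip: mscale_of_real)
qed

lemma ns_feasible_code:
  fixes C :: "('m::finite, 'a::finite, 'b::finite) code"
  assumes "ns_code C"
  shows "ns_feasible CARD('m) (code_F (choi C)) (code_rho (choi C))"
proof -
  let ?Z = "choi C"
  have Z: "psd ?Z" "marg_AiBi ?Z = mat 1"
    "marg_AiBiBo ?Z = mscale (1 / of_nat CARD('m)) (mat 1) \<otimes> marg_BiBo ?Z"
    "marg_BiAiAo ?Z = mscale (1 / of_nat CARD('b)) (mat 1) \<otimes> marg_AiAo ?Z"
    using assms by (simp_all add: ns_code_def Let_def)
  have block: "psd (message_block k l ?Z)" for k l
    unfolding message_block_def using Z(1) by (rule psd_reorder)
  have F: "psd (code_F ?Z)"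
    unfolding code_F_def by (intro psd_scaleR psd_transpose psd_sum block) simp
  have RF: "psd (code_rho ?Z \<otimes> mat 1 - code_F ?Z)"
    unfolding kron_mat_minus_code_F[OF Z(4)]
    by (intro psd_scaleR psd_transpose psd_sum block) simp
  have "psd (marg_AiAo ?Z)"
  proof -
    \<comment> \<open>A partial trace is a sum of compressions, one for each basis index of the
      discarded systems, and so preserves positivity.\<close>
    have "marg_AiAo ?Z = (\<Sum>y\<in>UNIV. reorder (\<lambda>(k, a). ((k, fst y), (a, snd y))) ?Z)"
      by (simp add: vec_eq_iff marg_AiAo_nth reorder_def sum_UNIV_prod)
    then show ?thesis
      by (simp add: psd_sum psd_reorder[OF Z(1)])
  qed
  then have "psd (code_rho ?Z)"
    unfolding code_rho_def by (intro psd_scaleR psd_transpose psd_sum psd_reorder) simp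
  with F RF trace_code_rho[OF Z(2)] ptrace_code_F[OF Z(2,3)] show ?thesis
    by (simp add: ns_feasible_def loewner_le_def psd_def)
qed

text \<open>Within a block the index of B_o is fixed, so transposing B_o has no effect there, and
  the partial transpose of a block is a block of the partially transposed \<open>Z\<close>. Since
  \<open>\<rho> \<otimes> mat 1\<close> is unchanged by the partial transpose, the formula for the
  slack applies once more.\<close>

lemma ppt_feasible_code:
  fixes C :: "('m::finite, 'a::finite, 'b::finite) code"
  assumes "ns_code C" and "ppt_code C"
  shows "ppt_feasible (code_F (choi C)) (code_rho (choi C))"
proof -
  let ?Z = "choi C"
  have Z: "marg_BiAiAo ?Z = mscale (1 / of_nat CARD('b)) (mat 1) \<otimes> marg_AiAo ?Z"
    using assms by (simp_all add: ns_code_def Let_def)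
  have block: "psd (ptranspose (message_block k l ?Z))" for k l
  proof -
    have "ptranspose (message_block k l ?Z) = reorder (\<lambda>(a, b). ((k, a), (b, l)))
        (ptranspose (reorder (\<lambda>((ai, ao), (bi, bo)). ((ai, bi), (ao, bo))) ?Z))"
      by (simp add: vec_eq_iff ptranspose_def reorder_def message_block_def)
    then show ?thesis
      using assms(2) by (simp add: ppt_code_def psd_reorder)
  qed
  have "psd (ptranspose (code_F ?Z))"
    unfolding code_F_def ptranspose_scaleR ptranspose_transpose ptranspose_sum
    by (intro psd_scaleR psd_transpose psd_sum block) simp
  moreover have "psd (code_rho ?Z \<otimes> mat 1 - ptranspose (code_F ?Z))"
  proof -
    have "code_rho ?Z \<otimes> mat 1 - ptranspose (code_F ?Z) =
        ptranspose (code_rho ?Z \<otimes> mat 1 - code_F ?Z)"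
      by (simp add: ptranspose_diff ptranspose_kron_mat)
    also have "psd \<dots>"
      unfolding kron_mat_minus_code_F[OF Z] ptranspose_scaleR ptranspose_transpose ptranspose_sum
      by (intro psd_scaleR psd_transpose psd_sum block) simp
    finally show ?thesis .
  qed
  ultimately show ?thesis
    by (simp add: ppt_feasible_def loewner_le_def)
qed

section \<open>From feasible pairs to codes\<close>

text \<open>Such a matrix is dephased on A_i and B_o and invariant under permuting the messages on
  both simultaneously. The pair (a_i, b_o) is the block label and (a_o, b_i) the position, matching
  \<open>psd_block_diagonal\<close>.\<close>

definition twirled_choi :: "('a \<times> 'b) op \<Rightarrow> ('a \<times> 'b) op \<Rightarrow> ('m::finite, 'a::finite, 'b::finite) code_choi"
  where "twirled_choi D E = (\<chi> p q.
    if (fst (fst p), snd (snd p)) = (fst (fst q), snd (snd q))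
    then (case (fst (fst p), snd (snd p)) of (k, l) \<Rightarrow> if k = l then D else E)
      $ (fst (snd p), snd (fst p)) $ (fst (snd q), snd (fst q))
    else 0)"

lemma twirled_choi_nth:
  "twirled_choi D E $ ((k, b), (a, l)) $ ((k', b'), (a', l')) =
    (if k = k' \<and> l = l' then (if k = l then D else E) $ (a, b) $ (a', b') else 0)"
  by (simp add: twirled_choi_def)

lemma psd_twirled_choi:
  assumes "psd D" and "psd E" shows "psd (twirled_choi D E)"
  unfolding twirled_choi_def
  by (rule psd_block_diagonal) (use assms in \<open>auto split: prod.split\<close>)

text \<open>Nonzero entries have equal row and column labels on B_o, so the partial transpose keeps
  the block structure and acts inside each block.\<close>

lemma psd_ptranspose_twirled_choi:
  assumes "psd (ptranspose D)" and "psd (ptranspose E)"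
  shows "psd (ptranspose (reorder (\<lambda>((ai, ao), (bi, bo)). ((ai, bi), (ao, bo)))
    (twirled_choi D E :: ('m::finite, 'a::finite, 'b::finite) code_choi)))"
proof -
  let ?g = "\<lambda>p :: ('m \<times> 'a) \<times> ('b \<times> 'm). (fst (fst p), snd (snd p))"
  let ?h = "\<lambda>p :: ('m \<times> 'a) \<times> ('b \<times> 'm). (snd (fst p), fst (snd p))"
  let ?A = "\<lambda>(k, l). if k = l then ptranspose D else ptranspose E"
  have "psd (\<chi> p q. if ?g p = ?g q then ?A (?g p) $ ?h p $ ?h q else 0)"
    by (rule psd_block_diagonal) (use assms in \<open>auto split: prod.split\<close>)
  also have "(\<chi> p q. if ?g p = ?g q then ?A (?g p) $ ?h p $ ?h q else 0) =
      ptranspose (reorder (\<lambda>((ai, ao), (bi, bo)). ((ai, bi), (ao, bo))) (twirled_choi D E))"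
    by (auto simp: vec_eq_iff ptranspose_def reorder_def twirled_choi_nth)
  finally show ?thesis .
qed

lemma code_F_twirled_choi:
  "code_F (twirled_choi D E :: ('m::finite, 'a::finite, 'b::finite) code_choi) = transpose D"
proof -
  have block: "message_block k k (twirled_choi D E :: ('m, 'a, 'b) code_choi) = D" for k
    by (simp add: vec_eq_iff message_block_nth twirled_choi_nth)
  have "code_F (twirled_choi D E :: ('m, 'a, 'b) code_choi) =
      (1 / of_nat CARD('m)) *\<^sub>R transpose (of_nat CARD('m) *\<^sub>R D)"
    by (simp only: code_F_def block sum_constant_scaleR)
  also have "\<dots> = transpose D"
    by (simp add: vec_eq_iff transpose_def)
  finally show ?thesis .
qed

lemma sum_if_eq:
  fixes x y :: complex
  shows "(\<Sum>l\<in>(UNIV :: 'm::finite set). if k = l then x else y) = x + of_nat (CARD('m) - 1) * y"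
proof -
  have "(\<Sum>l\<in>UNIV. if k = l then x else y) = x + (\<Sum>l\<in>UNIV - {k}. if k = l then x else y)"
    by (subst sum.remove[of UNIV k]) simp_all
  also have "(\<Sum>l\<in>UNIV - {k}. if k = l then x else y) = (\<Sum>l\<in>UNIV - {k}. y)"
    by (intro sum.cong) auto
  also have "\<dots> = of_nat (CARD('m) - 1) * y"
    by (simp add: card_Diff_singleton)
  finally show ?thesis .
qed

text \<open>\<open>D\<close> and \<open>E\<close> have the same partial trace over A, so after A_o
  is discarded nothing shows whether a_i equals b_o, and A cannot signal to B. For each a_i, summing
  over b_o meets \<open>D\<close> once and \<open>E\<close> for every other message; the total has
  an identity on B_i, so B cannot signal to A.\<close>

lemma ns_code_twirled_choi:
  fixes D E :: "('a::finite \<times> 'b::finite) op"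
  assumes "psd D" and "psd E"
    and ptrace: "ptrace_fst D = mscale (1 / of_nat CARD('m)) (mat 1)"
      "ptrace_fst E = mscale (1 / of_nat CARD('m)) (mat 1)"
    and total: "D + of_nat (CARD('m) - 1) *\<^sub>R E = \<sigma> \<otimes> mat 1"
  shows "ns_code (of_choi (twirled_choi D E :: ('m::finite, 'a, 'b) code_choi))"
proof -
  let ?Z = "twirled_choi D E :: ('m, 'a, 'b) code_choi"
  have over_a: "(\<Sum>a\<in>UNIV. (if c then D else E) $ (a, b) $ (a, b')) =
      (if b = b' then 1 / of_nat CARD('m) else 0)" for b b' c
  proof -
    have "(\<Sum>a\<in>UNIV. (if c then D else E) $ (a, b) $ (a, b')) = ptrace_fst (if c then D else E) $ b $ b'"
      by (simp add: ptrace_fst_nth)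
    also have "\<dots> = (if b = b' then 1 / of_nat CARD('m) else 0)"
      by (simp add: ptrace mscale_def mat_def map_matrix_def)
    finally show ?thesis .
  qed
  have over_l: "(\<Sum>l\<in>UNIV. (if k = l then D else E) $ (a, b) $ (a', b')) =
      (if b = b' then \<sigma> $ a $ a' else 0)" for k :: 'm and a a' b b'
  proof -
    have "(\<Sum>l\<in>UNIV. (if k = l then D else E) $ (a, b) $ (a', b')) =
        (\<Sum>l\<in>UNIV. if k = l then D $ (a, b) $ (a', b') else E $ (a, b) $ (a', b'))"
      by (intro sum.cong) auto
    also have "\<dots> = (D + of_nat (CARD('m) - 1) *\<^sub>R E) $ (a, b) $ (a', b')"
      unfolding sum_if_eq vector_add_component vector_scaleR_component
      by (simp only: scaleR_conv_of_real of_real_of_nat_eq)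
    also have "\<dots> = (if b = b' then \<sigma> $ a $ a' else 0)"
      unfolding total by (simp add: kron_def mat_def)
    finally show ?thesis .
  qed
  have AiBiBo: "marg_AiBiBo ?Z $ (k, b, l) $ (k', b', l') =
      (if k = k' \<and> b = b' \<and> l = l' then 1 / of_nat CARD('m) else 0)" for k b l k' b' l'
    by (cases "k = k' \<and> l = l'") (auto simp: marg_AiBiBo_nth twirled_choi_nth over_a)
  have BiBo: "marg_BiBo ?Z = mat 1"
  proof -
    have "marg_BiBo ?Z $ (b, l) $ (b', l') = (\<Sum>k\<in>UNIV. marg_AiBiBo ?Z $ (k, b, l) $ (k, b', l'))" for b l b' l'
      by (simp add: marg_BiBo_nth marg_AiBiBo_nth)
    then show ?thesis
      by (auto simp: vec_eq_iff AiBiBo mat_def)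
  qed
  have AiBi: "marg_AiBi ?Z = mat 1"
  proof -
    have "marg_AiBi ?Z $ (k, b) $ (k', b') = (\<Sum>l\<in>UNIV. marg_AiBiBo ?Z $ (k, b, l) $ (k', b', l))" for k b k' b'
      by (simp add: marg_AiBi_nth marg_AiBiBo_nth)
    then show ?thesis
      by (auto simp: vec_eq_iff AiBiBo mat_def)
  qed
  have BiAiAo: "marg_BiAiAo ?Z $ (b, k, a) $ (b', k', a') =
      (if k = k' \<and> b = b' then \<sigma> $ a $ a' else 0)" for k b a k' b' a'
    by (cases "k = k'") (simp_all add: marg_BiAiAo_nth twirled_choi_nth over_l)
  have AiAo: "marg_AiAo ?Z $ (k, a) $ (k', a') = (if k = k' then of_nat CARD('b) * \<sigma> $ a $ a' else 0)" for k a k' a'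
  proof -
    have "marg_AiAo ?Z $ (k, a) $ (k', a') = (\<Sum>b\<in>UNIV. marg_BiAiAo ?Z $ (b, k, a) $ (b, k', a'))"
      by (simp add: marg_AiAo_nth marg_BiAiAo_nth)
    then show ?thesis by (simp add: BiAiAo)
  qed
  have "marg_AiBiBo ?Z = mscale (1 / of_nat CARD('m)) (mat 1) \<otimes> marg_BiBo ?Z"
    by (auto simp: vec_eq_iff AiBiBo BiBo kron_def mscale_def mat_def map_matrix_def)
  moreover have "marg_BiAiAo ?Z = mscale (1 / of_nat CARD('b)) (mat 1) \<otimes> marg_AiAo ?Z"
    by (auto simp: vec_eq_iff BiAiAo AiAo kron_def mscale_def mat_def map_matrix_def)
  ultimately show ?thesis
    using psd_twirled_choi[OF assms(1,2)] AiBi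
    by (simp add: ns_code_def Let_def choi_of_choi op_linear_of_choi)
qed

text \<open>For one message the partial trace of \<open>F\<close> is the full identity, so
  \<open>F\<close> and its upper bound have equal traces; their difference is positive with trace
  zero.\<close>

lemma ns_feasible_trivial:
  fixes F :: "('a::finite \<times> 'b::finite) op"
  assumes "ns_feasible 1 F \<rho>" shows "F = \<rho> \<otimes> mat 1"
proof -
  have "trace F = trace (ptrace_fst F)"
    by (rule trace_ptrace_fst[symmetric])
  also have "\<dots> = of_nat CARD('b)"
    using assms by (simp add: ns_feasible_def mscale_def map_matrix_def trace_def mat_def)
  finally have "trace (\<rho> \<otimes> mat 1 - F) = 0"
    using assms by (simp add: trace_sub trace_kron_mat ns_feasible_def)
  then have "\<rho> \<otimes> mat 1 - F = 0"
    using assms by (intro psd_trace_zero) (simp_all add: ns_feasible_def loewner_le_def)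
  then show ?thesis by simp
qed

text \<open>
  For a single message the off-diagonal blocks do not occur, and \<open>D\<close> serves as a dummy for
  \<open>E\<close>.
\<close>

lemma feasible_code_exists:
  fixes F :: "('a::finite \<times> 'b::finite) op"
  assumes "ns_feasible CARD('m::finite) F \<rho>"
  shows "\<exists>C :: ('m, 'a, 'b) code. ns_code C \<and> code_F (choi C) = F \<and> (ppt_feasible F \<rho> \<longrightarrow> ppt_code C)"
proof -
  let ?R = "\<rho> \<otimes> (mat 1 :: 'b op)"
  define D where "D = transpose F"
  define E where "E = (if CARD('m) = 1 then D
    else (1 / of_nat (CARD('m) - 1)) *\<^sub>R transpose (?R - F))"
  have m: "CARD('m) = 1 \<or> CARD('m) - 1 > 0"
    using zero_less_card_finite[where 'a = 'm] by linarith
  have F: "psd F" "psd (?R - F)" "trace \<rho> = 1"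
      "ptrace_fst F = mscale (1 / of_nat CARD('m)) (mat 1)"
    using assms by (simp_all add: ns_feasible_def loewner_le_def)
  have D: "psd D"
    unfolding D_def using F(1) by (rule psd_transpose)
  have E: "psd E"
    using D F(2) by (simp add: E_def psd_scaleR psd_transpose)
  have F_sum: "(\<Sum>a\<in>UNIV. F $ (a, b) $ (a, b')) = (if b = b' then 1 / of_nat CARD('m) else 0)" for b b'
    using arg_cong[OF F(4), of "\<lambda>X. X $ b $ b'"]
    by (simp add: ptrace_fst_nth mscale_def map_matrix_def mat_def)
  have ptrace_D: "ptrace_fst D = mscale (1 / of_nat CARD('m)) (mat 1)"
    by (auto simp: vec_eq_iff ptrace_fst_nth D_def transpose_def F_sum mscale_def map_matrix_def mat_def)
  \<comment> \<open>For at least two messages, the partial trace of \<open>?R - F\<close> is 1 - 1/m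
    times the identity, and division by m - 1 gives 1/m again.\<close>
  have ptrace_E: "ptrace_fst E = mscale (1 / of_nat CARD('m)) (mat 1)"
  proof (cases "CARD('m) = 1")
    case True
    then show ?thesis using ptrace_D by (simp add: E_def)
  next
    case False
    have "(\<Sum>a\<in>UNIV. \<rho> $ a $ a) = 1"
      using F(3) by (simp add: trace_def)
    then have R_sum: "(\<Sum>a\<in>UNIV. ?R $ (a, b) $ (a, b')) = (if b = b' then 1 else 0)" for b b'
      by (simp add: kron_def mat_def)
    have "ptrace_fst E $ b $ b' = (1 / of_nat (CARD('m) - 1)) *\<^sub>R
        ((\<Sum>a\<in>UNIV. ?R $ (a, b') $ (a, b)) - (\<Sum>a\<in>UNIV. F $ (a, b') $ (a, b)))" for b b'
      using False by (simp add: E_def ptrace_fst_nth transpose_def sum_subtractf scaleR_sum_right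
          scaleR_diff_right)
    also have "(1 / of_nat (CARD('m) - 1)) *\<^sub>R
        ((\<Sum>a\<in>UNIV. ?R $ (a, b') $ (a, b)) - (\<Sum>a\<in>UNIV. F $ (a, b') $ (a, b))) =
        (if b = b' then 1 / of_nat CARD('m) else 0)" for b b'
      unfolding R_sum F_sum using False m
      by (simp add: scaleR_conv_of_real of_nat_diff Suc_leI field_simps)
    finally show ?thesis
      by (simp add: vec_eq_iff mscale_def map_matrix_def mat_def)
  qed
  \<comment> \<open>With one message the coefficient of \<open>E\<close> is 0, and the claim holds
    because \<open>F\<close> then attains its upper bound; otherwise m - 1 cancels the denominator
    in \<open>E\<close>.\<close>
  have total: "D + of_nat (CARD('m) - 1) *\<^sub>R E = transpose \<rho> \<otimes> mat 1"
  proof (cases "CARD('m) = 1")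
    case True
    then have "F = ?R"
      using assms ns_feasible_trivial by metis
    then show ?thesis
      using True by (simp add: D_def transpose_kron)
  next
    case False
    then show ?thesis
      using m by (simp add: E_def D_def transpose_diff transpose_kron)
  qed
  let ?C = "of_choi (twirled_choi D E :: ('m, 'a, 'b) code_choi)"
  have "ns_code ?C"
    using D E ptrace_D ptrace_E total by (rule ns_code_twirled_choi)
  moreover have "code_F (choi ?C) = F"
    by (simp add: choi_of_choi code_F_twirled_choi D_def)
  moreover have "ppt_code ?C" if "ppt_feasible F \<rho>"
  proof -
    have F: "psd (ptranspose F)" "psd (?R - ptranspose F)"
      using that by (simp_all add: ppt_feasible_def loewner_le_def)
    have "psd (ptranspose D)"
      unfolding D_def ptranspose_transpose using F(1) by (rule psd_transpose)
    moreover have "psd (ptranspose E)"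
      using F(2) \<open>psd (ptranspose D)\<close>
      by (simp add: E_def ptranspose_scaleR ptranspose_transpose ptranspose_diff ptranspose_kron_mat
          psd_scaleR psd_transpose)
    ultimately show ?thesis
      unfolding ppt_code_def choi_of_choi by (rule psd_ptranspose_twirled_choi)
  qed
  ultimately show ?thesis by blast
qed

section \<open>Attainment of the optimum and the two programs\<close>

text \<open>Compactness is known for the feasible pairs only. Equality of the two value sets carries
  the attained maximum over to the supremum over codes.\<close>

lemma is_maximum_SUP:
  fixes f :: "'x::topological_space \<Rightarrow> real" and g :: "'y \<Rightarrow> real"
  assumes "compact K" and "K \<noteq> {}" and "continuous_on K f" and "g ` G = f ` K"
  shows "is_maximum {ereal (f x) |x. x \<in> K} (SUP y\<in>G. ereal (g y))"
proof -
  obtain x where x: "x \<in> K" "\<And>y. y \<in> K \<Longrightarrow> f y \<le> f x"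
    using continuous_attains_sup[OF assms(1-3)] by blast
  have "(\<lambda>y. ereal (g y)) ` G = (\<lambda>x. ereal (f x)) ` K"
    using assms(4) by (metis image_image)
  then have "(SUP y\<in>G. ereal (g y)) = (SUP x\<in>K. ereal (f x))"
    by simp
  also have "\<dots> = ereal (f x)"
    using x by (intro SUP_eqI) auto
  finally show ?thesis
    using x by (auto simp: is_maximum_def)
qed

theorem theorem3:
  fixes N :: "'a::finite op \<Rightarrow> 'b::finite op"
    and m :: nat
  assumes "quantum_channel N"
    and "m = CARD('m::finite)"
  shows "is_maximum
      {ereal (Re (trace (choi N ** F))) |(F :: ('a \<times> 'b) op) (\<rho> :: 'a op).
        hermitian F \<and> hermitian \<rho> \<and>
        0 \<preceq> F \<and> F \<preceq> \<rho> \<otimes> mat 1 \<and>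
        trace \<rho> = 1 \<and>
        ptrace_fst F = mscale (1 / of_nat m) (mat 1) \<and>
        0 \<preceq> ptranspose F \<and> ptranspose F \<preceq> \<rho> \<otimes> mat 1}
      (f_NS_PPT N TYPE('m)) \<and>
    is_maximum
      {ereal (Re (trace (choi N ** F))) |(F :: ('a \<times> 'b) op) (\<rho> :: 'a op).
        hermitian F \<and> hermitian \<rho> \<and>
        0 \<preceq> F \<and> F \<preceq> \<rho> \<otimes> mat 1 \<and>
        trace \<rho> = 1 \<and>
        ptrace_fst F = mscale (1 / of_nat m) (mat 1)}
      (f_NS N TYPE('m))"
proof -
  let ?f = "\<lambda>x :: ('a \<times> 'b) op \<times> 'a op. Re (trace (choi N ** fst x))"
  let ?K = "{x :: ('a \<times> 'b) op \<times> 'a op. ns_feasible m (fst x) (snd x)}"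
  let ?P = "{x :: ('a \<times> 'b) op \<times> 'a op. ppt_feasible (fst x) (snd x)}"
  have cont: "continuous_on S ?f" for S
    by (intro continuous_intros)
  have K: "compact ?K"
    by (rule compact_ns_feasible)
  have KP: "compact (?K \<inter> ?P)"
    using K closed_ppt_feasible by (rule compact_Int_closed)
  have ne: "?K \<inter> ?P \<noteq> {}"
  proof -
    obtain F :: "('a \<times> 'b) op" and \<rho> where "ns_feasible m F \<rho> \<and> ppt_feasible F \<rho>"
      using feasible_nonempty[of m] assms(2) by auto
    then have "(F, \<rho>) \<in> ?K \<inter> ?P" by simp
    then show ?thesis by blast
  qed
  have feas: "ns_feasible m (code_F (choi C)) (code_rho (choi C))" if "ns_code C" for C :: "('m, 'a, 'b) code"
    using ns_feasible_code[OF that] by (simp add: assms(2))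
  \<comment> \<open>The same construction serves both programs, since its PPT property is stated as
    an implication.\<close>
  have code: "\<exists>C :: ('m, 'a, 'b) code. ns_code C \<and> success_prob N C = ?f x \<and> (x \<in> ?P \<longrightarrow> ppt_code C)"
    if "x \<in> ?K" for x
    using feasible_code_exists[where F = "fst x" and \<rho> = "snd x" and 'm = 'm] that assms(2)
    by (auto simp: success_prob_eq)
  have "success_prob N ` {C :: ('m, 'a, 'b) code. ns_code C \<and> ppt_code C} = ?f ` (?K \<inter> ?P)"
  proof (intro equalityI subsetI; elim imageE)
    fix r and C :: "('m, 'a, 'b) code"
    assume "r = success_prob N C" and "C \<in> {C. ns_code C \<and> ppt_code C}"
    then show "r \<in> ?f ` (?K \<inter> ?P)"
      using feas[of C] ppt_feasible_code[of C]
      by (intro image_eqI[of _ _ "(code_F (choi C), code_rho (choi C))"]) (simp_all add: success_prob_eq)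
  next
    fix r x assume "r = ?f x" and "x \<in> ?K \<inter> ?P"
    then show "r \<in> success_prob N ` {C :: ('m, 'a, 'b) code. ns_code C \<and> ppt_code C}"
      using code[of x] by (metis (mono_tags, lifting) IntE image_eqI mem_Collect_eq)
  qed
  from is_maximum_SUP[OF KP ne cont this] have "is_maximum {ereal (?f x) |x. x \<in> ?K \<inter> ?P} (f_NS_PPT N TYPE('m))"
    by (simp only: f_NS_PPT_def opt_success_def)
  moreover have "success_prob N ` {C :: ('m, 'a, 'b) code. ns_code C} = ?f ` ?K"
  proof (intro equalityI subsetI; elim imageE)
    fix r and C :: "('m, 'a, 'b) code"
    assume "r = success_prob N C" and "C \<in> {C. ns_code C}"
    then show "r \<in> ?f ` ?K"
      using feas[of C]
      by (intro image_eqI[of _ _ "(code_F (choi C), code_rho (choi C))"]) (simp_all add: success_prob_eq)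
  next
    fix r x assume "r = ?f x" and "x \<in> ?K"
    then show "r \<in> success_prob N ` {C :: ('m, 'a, 'b) code. ns_code C}"
      using code[of x] by (metis (mono_tags, lifting) image_eqI mem_Collect_eq)
  qed
  from is_maximum_SUP[OF K _ cont this] ne have "is_maximum {ereal (?f x) |x. x \<in> ?K} (f_NS N TYPE('m))"
    unfolding f_NS_def opt_success_def by blast
  ultimately show ?thesis
    by (simp add: ns_feasible_def ppt_feasible_def conj_assoc)
qed

end
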